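(* Let $\alpha,\theta>0$, $p\in(0,1)$, let $\{N(t),\,t\ge0\}$ be a Bell-Touchard process with parameters $(\alpha,\theta)$, and let $\{N_1(t),\,t\ge0\}$ be a decomposition of $\{N(t),\,t\ge0\}$ with rate $p$. Then $\{N_1(t),\,t\ge0\}$ is a Bell-Touchard process with parameters $(\alpha^*,\theta^* )$, where $\alpha^*:=\alpha e^{(1-p)\theta}$ and $\theta^*:=p\theta$.
   Context: $\mathbb{N}=\{1,2,\dots\}$, $\mathbb{N}_0=\mathbb{N}\cup\{0\}$. A counting process $\{N(t),t\ge0\}$ is an $\mathbb{N}_0$-valued stochastic process where $N(t)$ is the number of events that have occurred up to time $t$ (so it is nondecreasing in $t$). A function $f:\mathbb{R}\to\mathbb{R}$ is $o(s)$ if $\lim_{s\to0}f(s)/s=0$. A counting process is a Bell-Touchard process with parameters $(\alpha,\theta)$, $\alpha,\theta>0$, if (1) $N(0)=0$; (2) it has stationary and independent increments; (3) $\Pr[N(t+s)-N(t)=k]=\alpha s\,\theta^k/k!+o(s)$ for every $k\in\mathbb{N}$ and $s,t>0$. Decomposition with rate $p$: each event counted by $N$ is classified, independently of all other events and of the process $N$, as type I with probability $p$ or type II with probability $1-p$; $N_1(t)$ denotes the number of type I events up to time $t$ (so, given $N(t)=n$, $N_1(t)$ is binomial with parameters $n,p$). *)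

theory Defs
  imports "HOL-Probability.Probability"
begin

text \<open>Processes have type \<open>real \<Rightarrow> 'a \<Rightarrow> nat\<close>; only the values at times \<open>t \<ge> 0\<close> are
  constrained. Truncated subtraction computes the true increment over an
  interval \<open>[s, t]\<close> with \<open>0 \<le> s\<close>, because paths are nondecreasing.\<close>

locale counting_process = prob_space M for M :: "'a measure" +
  fixes N :: "real \<Rightarrow> 'a \<Rightarrow> nat"
  assumes random_variable_process: "\<And>t. 0 \<le> t \<Longrightarrow> random_variable (count_space UNIV) (N t)"
    and nondecreasing: "\<And>\<omega>. \<omega> \<in> space M \<Longrightarrow> mono_on {0..} (\<lambda>t. N t \<omega>)"
begin

definition stationary_increments :: bool where
  "stationary_increments \<longleftrightarrow>
     (\<forall>t\<ge>0. \<forall>s\<ge>0.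
        distr M (count_space UNIV) (\<lambda>\<omega>. N (t + s) \<omega> - N t \<omega>) =
        distr M (count_space UNIV) (\<lambda>\<omega>. N s \<omega> - N 0 \<omega>))"

definition independent_increments :: bool where
  "independent_increments \<longleftrightarrow>
     (\<forall>(n::nat) (\<tau> :: nat \<Rightarrow> real). 0 \<le> \<tau> 0 \<longrightarrow> (\<forall>i<n. \<tau> i < \<tau> (Suc i)) \<longrightarrow>
        indep_vars (\<lambda>_. count_space UNIV) (\<lambda>i \<omega>. N (\<tau> (Suc i)) \<omega> - N (\<tau> i) \<omega>) {..<n})"

end

text \<open>The increment probability is meaningful only for lengths \<open>s > 0\<close>, so the
  remainder is \<open>o(s)\<close> as \<open>s\<close> tends to \<open>0\<close> from the right. \<open>N 0 = 0\<close> is required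
  on every path.\<close>

locale bell_touchard_process = counting_process M N
  for M :: "'a measure" and N :: "real \<Rightarrow> 'a \<Rightarrow> nat" +
  fixes \<alpha> \<theta> :: real
  assumes alpha_pos: "0 < \<alpha>"
    and theta_pos: "0 < \<theta>"
    and starts_at_zero: "\<And>\<omega>. \<omega> \<in> space M \<Longrightarrow> N 0 \<omega> = 0"
    and stationary: "stationary_increments"
    and independent: "independent_increments"
    and increment_prob: "\<And>(k::nat) t. \<lbrakk>1 \<le> k; 0 < t\<rbrakk> \<Longrightarrow>
      (\<lambda>s. prob {\<omega> \<in> space M. N (t + s) \<omega> - N t \<omega> = k} - \<alpha> * s * \<theta> ^ k / fact k)
        \<in> o[at_right 0](\<lambda>s. s)"

text \<open>The events counted by \<open>N\<close> are numbered \<open>0, 1, 2, \<dots>\<close> in order of occurrence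
  (simultaneous events in an arbitrary order), so those up to time \<open>t\<close> are the
  events \<open>i < N t \<omega>\<close>. The mark \<open>B i \<omega>\<close> says that event \<open>i\<close> is of type I. The marks
  are mutually independent, and as a family they are independent of the whole
  process \<open>(N t)\<close>, \<open>t \<ge> 0\<close>. The library constant \<open>indep_var\<close> needs both random
  variables to have the same value type, so this last independence is stated for
  the generated \<open>\<sigma>\<close>-algebras.\<close>

definition (in prob_space) decomposition ::
  "(real \<Rightarrow> 'a \<Rightarrow> nat) \<Rightarrow> real \<Rightarrow> (real \<Rightarrow> 'a \<Rightarrow> nat) \<Rightarrow> bool" where
  "decomposition N p N1 \<longleftrightarrow>
     (\<exists>B :: nat \<Rightarrow> 'a \<Rightarrow> bool.
        indep_vars (\<lambda>_. count_space UNIV) B UNIV \<and>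
        (\<forall>i. prob {\<omega> \<in> space M. B i \<omega>} = p) \<and>
        indep_set
          (sets (vimage_algebra (space M) (\<lambda>\<omega>. \<lambda>t\<in>{0..}. N t \<omega>)
                   (\<Pi>\<^sub>M t\<in>{0::real..}. count_space (UNIV :: nat set))))
          (sets (vimage_algebra (space M) (\<lambda>\<omega> i. B i \<omega>)
                   (\<Pi>\<^sub>M i\<in>UNIV. count_space (UNIV :: bool set)))) \<and>
        (\<forall>t\<ge>0. \<forall>\<omega>\<in>space M. N1 t \<omega> = card {i. i < N t \<omega> \<and> B i \<omega>}))"

end

theory Submission
  imports Defs
begin

text \<open>
  Why independent thinning preserves the Bell-Touchard property.

  Fix times \<open>\<tau> 0 \<le> \<dots> \<le> \<tau> n\<close>. Once the values of \<open>N\<close> at these times are known, the increments of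
  \<open>N1\<close> count the marks in consecutive disjoint blocks of indices, so they are independent
  binomial variables whose sizes are the increments of \<open>N\<close>. Since the marks are independent of \<open>N\<close>,
  averaging over the countably many possible values of \<open>(N (\<tau> 0), \<dots>, N (\<tau> n))\<close> shows that the event
  that the \<open>i\<close>-th increment of \<open>N1\<close> lies in \<open>A i\<close> for all \<open>i\<close> has probability
  \<open>E (\<Prod>i. Bin(\<Delta> i, p) (A i))\<close>, where \<open>\<Delta> i\<close> is the \<open>i\<close>-th increment of \<open>N\<close>
  (lemma \<open>prob_thinned_increments\<close>). Stationarity and independence of the increments of \<open>N1\<close> can be
  read off: the expectation depends only on the joint law of the \<open>\<Delta> i\<close>, and it factorises when they
  are independent.

  For one increment the same formula says that \<open>P (N1 (t + s) - N1 t = j)\<close> is the sum over \<open>k\<close> of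
  \<open>w k * P (N (t + s) - N t = k)\<close> with \<open>w k = Bin(k, p) {j}\<close>. Replacing each probability by its
  leading term \<open>\<alpha> * s * \<theta> ^ k / k!\<close> gives \<open>\<alpha> * s * exp ((1 - p) * \<theta>) * (p * \<theta>) ^ j / j!\<close>, the claimed
  rate. The point that needs care is that infinitely many remainders, each \<open>o(s)\<close> but without any
  uniformity in \<open>k\<close>, are added up. Two facts make the total \<open>o(s)\<close>. First, the weights \<open>w k\<close> tend to
  \<open>0\<close> as \<open>k \<rightarrow> \<infinity>\<close>. Second, \<open>P (N (t + s) - N t \<noteq> 0) \<le> C * s\<close> for small \<open>s\<close>, because
  \<open>q s = P (N s - N 0 = 0)\<close> is positive and satisfies \<open>q (n * s) = q s ^ n\<close>
  (lemma \<open>increment_nonzero_prob_linear\<close>). So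
  the remainders divided by \<open>s\<close> are bounded in \<open>\<ell>\<^sup>1\<close> and tend to \<open>0\<close> coordinatewise, and a sequence
  of weights vanishing at infinity sends such a family to \<open>0\<close>
  (lemma \<open>tendsto_suminf_vanishing_weights\<close>).
\<close>

section \<open>Weighted sums and binomial weights\<close>

text \<open>This is the statement that a bounded family in \<open>\<ell>\<^sup>1\<close> converging to \<open>0\<close> in every coordinate converges
  to \<open>0\<close> weakly-* as functionals on \<open>c\<^sub>0\<close>. Only finitely many coordinates carry a weight above
  \<open>\<delta>\<close>; they tend to \<open>0\<close> one by one, and all others together contribute at most \<open>\<delta> * C\<close>.
  A bound on the norms takes the place of the common majorant that dominated convergence asks for:
  the total mass is easier to control than the single probabilities uniformly in \<open>s\<close>.\<close>

lemma tendsto_suminf_vanishing_weights: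
  fixes b :: "nat \<Rightarrow> real" and f :: "'s \<Rightarrow> nat \<Rightarrow> real"
  assumes b: "b \<longlonglongrightarrow> 0"
    and bounded: "\<forall>\<^sub>F s in F. summable (\<lambda>k. \<bar>f s k\<bar>) \<and> (\<Sum>k. \<bar>f s k\<bar>) \<le> C"
    and pointwise: "\<And>k. ((\<lambda>s. f s k) \<longlongrightarrow> 0) F"
  shows "((\<lambda>s. \<Sum>k. b k * f s k) \<longlongrightarrow> 0) F"
proof (rule tendstoI)
  fix \<epsilon> :: real assume \<epsilon>: "0 < \<epsilon>"
  define \<delta> where "\<delta> = \<epsilon> / (2 * (\<bar>C\<bar> + 1))"
  have \<delta>: "0 < \<delta>" using \<epsilon> by (simp add: \<delta>_def)
  have \<delta>C: "\<delta> * \<bar>C\<bar> < \<epsilon> / 2"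
    using \<epsilon> by (simp add: \<delta>_def field_simps)
  obtain K where K: "\<And>k. k \<ge> K \<Longrightarrow> \<bar>b k\<bar> < \<delta>"
    using LIMSEQ_D[OF b \<delta>] by auto
  obtain R where R: "\<And>k. \<bar>b k\<bar> \<le> R"
    using convergent_imp_Bseq[OF convergentI[OF b]] by (auto simp: Bseq_def)
  have "((\<lambda>s. \<Sum>k<K. b k * f s k) \<longlongrightarrow> (\<Sum>k<K. b k * 0)) F"
    by (intro tendsto_sum tendsto_mult tendsto_const pointwise)
  from tendstoD[OF this, of "\<epsilon> / 2"] have "\<forall>\<^sub>F s in F. \<bar>\<Sum>k<K. b k * f s k\<bar> < \<epsilon> / 2"
    using \<epsilon> by (simp add: dist_real_def)
  then show "\<forall>\<^sub>F s in F. dist (\<Sum>k. b k * f s k) 0 < \<epsilon>"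
    using bounded
  proof eventually_elim
    case (elim s)
    have abs_sum: "summable (\<lambda>k. \<bar>b k * f s k\<bar>)"
      by (rule summable_comparison_test'[where g = "\<lambda>k. R * \<bar>f s k\<bar>" and N = 0])
         (use elim in \<open>auto intro!: summable_mult mult_right_mono R simp: abs_mult\<close>)
    have tail_f: "summable (\<lambda>k. \<bar>f s (k + K)\<bar>)"
      using elim by (subst summable_iff_shift[of "\<lambda>k. \<bar>f s k\<bar>"]) auto
    have tail_bf: "summable (\<lambda>k. \<bar>b (k + K) * f s (k + K)\<bar>)"
      using abs_sum by (subst summable_iff_shift[of "\<lambda>k. \<bar>b k * f s k\<bar>"])
    have "\<bar>\<Sum>k. b (k + K) * f s (k + K)\<bar> \<le> (\<Sum>k. \<bar>b (k + K) * f s (k + K)\<bar>)"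
      by (rule summable_rabs[OF tail_bf])
    also have "\<dots> \<le> (\<Sum>k. \<delta> * \<bar>f s (k + K)\<bar>)"
    proof (rule suminf_le)
      show "\<bar>b (k + K) * f s (k + K)\<bar> \<le> \<delta> * \<bar>f s (k + K)\<bar>" for k
        using K[of "k + K"] by (auto simp: abs_mult intro!: mult_right_mono)
    qed (use tail_bf tail_f in \<open>auto intro: summable_mult\<close>)
    also have "\<dots> = \<delta> * (\<Sum>k. \<bar>f s (k + K)\<bar>)"
      by (rule suminf_mult[OF tail_f])
    also have "(\<Sum>k. \<bar>f s (k + K)\<bar>) \<le> (\<Sum>k. \<bar>f s k\<bar>)"
      using suminf_split_initial_segment[of "\<lambda>k. \<bar>f s k\<bar>" K] elim
      by (simp add: sum_nonneg)
    also have "(\<Sum>k. \<bar>f s k\<bar>) \<le> \<bar>C\<bar>"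
      using elim by linarith
    finally have tail: "\<bar>\<Sum>k. b (k + K) * f s (k + K)\<bar> \<le> \<delta> * \<bar>C\<bar>"
      using \<delta> by simp
    have "(\<Sum>k. b k * f s k) = (\<Sum>k. b (k + K) * f s (k + K)) + (\<Sum>k<K. b k * f s k)"
      by (rule suminf_split_initial_segment) (rule summable_rabs_cancel[OF abs_sum])
    then show ?case
      using tail \<delta>C elim by (simp add: dist_real_def)
  qed
qed

text \<open>Up to a constant, the weight is at most \<open>k ^ j * (1 - p) ^ k\<close>, which is the \<open>j\<close>-th power of
  \<open>k * r ^ k\<close> for the \<open>j\<close>-th root \<open>r\<close> of \<open>1 - p\<close>.\<close>

lemma binomial_weight_tendsto_0:
  fixes p :: real
  assumes p: "0 < p" "p < 1" and j: "1 \<le> j"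
  shows "(\<lambda>k. pmf (binomial_pmf k p) j) \<longlonglongrightarrow> 0"
proof -
  define r where "r = root j (1 - p)"
  have r: "0 < r" "r < 1" "r ^ j = 1 - p"
    using p j by (auto simp: r_def)
  have "(\<lambda>k. real k * r ^ k) \<longlonglongrightarrow> 0"
    using r by (intro powser_times_n_limit_0) auto
  then have "(\<lambda>k. (real k * r ^ k) ^ j * (p / (1 - p)) ^ j) \<longlonglongrightarrow> 0 ^ j * (p / (1 - p)) ^ j"
    by (intro tendsto_intros)
  then have lim: "(\<lambda>k. (real k * r ^ k) ^ j * (p / (1 - p)) ^ j) \<longlonglongrightarrow> 0"
    using j by (simp add: zero_power)
  show ?thesis
  proof (rule tendsto_sandwich[OF _ _ tendsto_const lim])
    show "\<forall>\<^sub>F k in sequentially. pmf (binomial_pmf k p) j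
            \<le> (real k * r ^ k) ^ j * (p / (1 - p)) ^ j"
      using eventually_ge_at_top[of j]
    proof eventually_elim
      case (elim k)
      have "real (k choose j) \<le> real k ^ j"
        using binomial_le_pow[OF elim] by (metis of_nat_le_iff of_nat_power)
      moreover have "(r ^ k) ^ j = (1 - p) ^ k"
        by (metis r(3) power_mult mult.commute)
      moreover have "(1 - p) ^ (k - j) = (1 - p) ^ k / (1 - p) ^ j"
        using p elim by (simp add: power_diff)
      ultimately show ?case
        using p by (auto simp: power_mult_distrib power_divide divide_simps intro!: mult_right_mono)
    qed
  qed auto
qed

text \<open>Thinning a Poisson law: \<open>(k choose j) / k! = 1 / (j! * (k - j)!)\<close> splits off the factor
  \<open>(p * \<theta>) ^ j / j!\<close> and leaves the exponential series of \<open>(1 - p) * \<theta>\<close>. This is where the new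
  parameters come from.\<close>

lemma binomial_thinning_of_exponential_weights:
  fixes p \<theta> :: real
  assumes p: "0 \<le> p" "p \<le> 1"
  shows "(\<lambda>k. pmf (binomial_pmf k p) j * (\<theta> ^ k / fact k)) sums
           (exp ((1 - p) * \<theta>) * (p * \<theta>) ^ j / fact j)"
proof -
  have "(\<lambda>i. ((1 - p) * \<theta>) ^ i /\<^sub>R fact i * ((p * \<theta>) ^ j / fact j)) sums
          (exp ((1 - p) * \<theta>) * ((p * \<theta>) ^ j / fact j))"
    by (intro sums_mult2 exp_converges)
  moreover have "((1 - p) * \<theta>) ^ i /\<^sub>R fact i * ((p * \<theta>) ^ j / fact j) =
      pmf (binomial_pmf (i + j) p) j * (\<theta> ^ (i + j) / fact (i + j))" for i
  proof -
    have "((1 - p) * \<theta>) ^ i = (1 - p) ^ i * \<theta> ^ i" "(p * \<theta>) ^ j = p ^ j * \<theta> ^ j"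
      by (rule power_mult_distrib)+
    moreover have "real (i + j choose j) = fact (i + j) / (fact j * fact i)"
      by (simp add: binomial_fact)
    ultimately show ?thesis
      using p by (simp add: power_add divide_simps mult_ac)
  qed
  ultimately have "(\<lambda>i. pmf (binomial_pmf (i + j) p) j * (\<theta> ^ (i + j) / fact (i + j))) sums
          (exp ((1 - p) * \<theta>) * ((p * \<theta>) ^ j / fact j))"
    by simp
  then have "(\<lambda>k. pmf (binomial_pmf k p) j * (\<theta> ^ k / fact k)) sums
      (exp ((1 - p) * \<theta>) * ((p * \<theta>) ^ j / fact j) +
       (\<Sum>k<j. pmf (binomial_pmf k p) j * (\<theta> ^ k / fact k)))"
    by (rule sums_iff_shift[of "\<lambda>k. pmf (binomial_pmf k p) j * (\<theta> ^ k / fact k)", THEN iffD1])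
  then show ?thesis
    using p by (simp add: binomial_eq_0)
qed

section \<open>Discrete random variables and independent marks\<close>

context prob_space
begin

lemma prob_eq_prob_pmf:
  fixes X :: "'a \<Rightarrow> 'b::countable"
  assumes X: "random_variable (count_space UNIV) X"
    and eq: "\<And>k. prob {\<omega> \<in> space M. X \<omega> = k} = pmf q k"
  shows "prob {\<omega> \<in> space M. X \<omega> \<in> A} = measure_pmf.prob q A"
proof -
  have "distr M (count_space UNIV) X = measure_pmf q"
  proof (rule measure_eqI_countable[where A = UNIV])
    fix k :: 'b
    have "X -` {k} \<inter> space M = {\<omega> \<in> space M. X \<omega> = k}" by auto
    then show "emeasure (distr M (count_space UNIV) X) {k} = emeasure (measure_pmf q) {k}"
      using X eq[of k] by (simp add: emeasure_distr emeasure_eq_measure emeasure_pmf_single)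
  qed auto
  then have "measure_pmf.prob q A = measure (distr M (count_space UNIV) X) A" by simp
  also have "\<dots> = prob {\<omega> \<in> space M. X \<omega> \<in> A}"
    using X by (subst measure_distr) (auto intro!: arg_cong[where f = prob])
  finally show ?thesis by simp
qed

text \<open>Conditioning on a discrete variable \<open>X\<close>, written without conditional probabilities: on the event
  \<open>X = x\<close> the random event \<open>Q (X \<omega>)\<close> is the fixed event \<open>Q x\<close>, which is independent of \<open>X\<close>.\<close>

lemma prob_mixture:
  fixes X :: "'a \<Rightarrow> 'b::countable"
  assumes indep: "indep_set F G"
    and F: "\<And>x. {\<omega> \<in> space M. X \<omega> = x} \<in> F"
    and G: "\<And>x. Q x \<in> G"
  shows "prob {\<omega> \<in> space M. \<omega> \<in> Q (X \<omega>)} = expectation (\<lambda>\<omega>. prob (Q (X \<omega>)))"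
proof -
  have evF: "\<And>x. {\<omega> \<in> space M. X \<omega> = x} \<in> events"
    using indep_setD_ev1[OF indep] F by auto
  have evG: "\<And>x. Q x \<in> events"
    using indep_setD_ev2[OF indep] G by auto
  have X[measurable]: "random_variable (count_space UNIV) X"
    using evF by (auto simp: measurable_count_space_eq2_countable vimage_def Int_def conj_commute)
  have [measurable]: "{\<omega> \<in> space M. X \<omega> = x} \<in> events" for x by (rule evF)
  let ?S = "\<lambda>x. {\<omega> \<in> space M. X \<omega> = x} \<inter> Q x"
  have "{\<omega> \<in> space M. \<omega> \<in> Q (X \<omega>)} = (\<Union>x. ?S x)"
    using sets.sets_into_space[OF evG] by auto
  then have "emeasure M {\<omega> \<in> space M. \<omega> \<in> Q (X \<omega>)} = (\<integral>\<^sup>+x. emeasure M (?S x) \<partial>count_space UNIV)"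
    using evF evG by (auto simp: disjoint_family_on_def intro!: emeasure_UN_countable)
  also have "\<dots> = (\<integral>\<^sup>+x. (\<integral>\<^sup>+\<omega>. ennreal (prob (Q x)) * indicator {\<omega> \<in> space M. X \<omega> = x} \<omega> \<partial>M)
                     \<partial>count_space UNIV)"
    using indep_setD[OF indep F G]
    by (intro nn_integral_cong)
       (simp add: nn_integral_cmult_indicator evF emeasure_eq_measure ennreal_mult'' mult.commute)
  also have "\<dots> = (\<integral>\<^sup>+\<omega>. (\<integral>\<^sup>+x. ennreal (prob (Q x)) * indicator {\<omega> \<in> space M. X \<omega> = x} \<omega>
                     \<partial>count_space UNIV) \<partial>M)"
    by (rule nn_integral_count_space_nn_integral[symmetric]) auto
  also have "\<dots> = (\<integral>\<^sup>+\<omega>. ennreal (prob (Q (X \<omega>))) \<partial>M)"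
  proof (rule nn_integral_cong)
    fix \<omega> assume "\<omega> \<in> space M"
    then show "(\<integral>\<^sup>+x. ennreal (prob (Q x)) * indicator {\<omega> \<in> space M. X \<omega> = x} \<omega> \<partial>count_space UNIV)
        = ennreal (prob (Q (X \<omega>)))"
      by (subst nn_integral_count_space'[where A = "{X \<omega>}"]) auto
  qed
  also have "\<dots> = ennreal (expectation (\<lambda>\<omega>. prob (Q (X \<omega>))))"
    by (rule nn_integral_eq_integral)
       (auto intro!: integrable_const_bound[where B = 1] measurable_compose[OF X])
  finally show ?thesis
    by (simp add: emeasure_eq_measure integral_nonneg)
qed

lemma expectation_discrete_sums:
  fixes X :: "'a \<Rightarrow> nat" and w :: "nat \<Rightarrow> real"
  assumes X[measurable]: "random_variable (count_space UNIV) X"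
    and w: "\<And>k. 0 \<le> w k" "\<And>k. w k \<le> 1"
  shows "(\<lambda>k. w k * prob {\<omega> \<in> space M. X \<omega> = k}) sums expectation (\<lambda>\<omega>. w (X \<omega>))"
proof -
  have total: "(\<lambda>k. prob {\<omega> \<in> space M. X \<omega> = k}) sums prob (\<Union>k. {\<omega> \<in> space M. X \<omega> = k})"
    by (rule finite_measure_UNION) (auto simp: disjoint_family_on_def)
  let ?f = "\<lambda>k \<omega>. w k * indicator {\<omega> \<in> space M. X \<omega> = k} \<omega>"
  have single: "(\<lambda>k. ?f k \<omega>) sums w (X \<omega>)" if "\<omega> \<in> space M" for \<omega>
    using sums_finite[of "{X \<omega>}" "\<lambda>k. ?f k \<omega>"] that by auto
  have int_ind [simp]: "integrable M (indicat_real {\<omega> \<in> space M. X \<omega> = k})" for k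
    by (simp add: emeasure_eq_measure)
  have int_f: "(\<integral>\<omega>. ?f k \<omega> \<partial>M) = w k * prob {\<omega> \<in> space M. X \<omega> = k}" for k
    by (simp add: measure_def)
  have "(\<lambda>k. \<integral>\<omega>. ?f k \<omega> \<partial>M) sums (\<integral>\<omega>. (\<Sum>k. ?f k \<omega>) \<partial>M)"
  proof (rule sums_integral)
    show "AE \<omega> in M. summable (\<lambda>k. norm (?f k \<omega>))"
      using w single by (auto simp: sums_iff abs_mult)
    have "(\<integral>\<omega>. norm (?f k \<omega>) \<partial>M) = w k * prob {\<omega> \<in> space M. X \<omega> = k}" for k
      using w by (subst int_f[symmetric]) (simp add: abs_mult)
    moreover have "summable (\<lambda>k. w k * prob {\<omega> \<in> space M. X \<omega> = k})"
      by (rule summable_comparison_test'[OF sums_summable[OF total], of 0])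
         (use w in \<open>auto simp: abs_mult intro!: mult_left_le_one_le\<close>)
    ultimately show "summable (\<lambda>k. \<integral>\<omega>. norm (?f k \<omega>) \<partial>M)" by simp
  qed auto
  moreover have "(\<integral>\<omega>. (\<Sum>k. ?f k \<omega>) \<partial>M) = expectation (\<lambda>\<omega>. w (X \<omega>))"
    by (rule Bochner_Integration.integral_cong) (use single in \<open>auto simp: sums_iff\<close>)
  ultimately show ?thesis by (simp only: int_f)
qed

text \<open>The subset of marked indices equals a given \<open>S\<close> with probability
  \<open>p ^ card S * (1 - p) ^ (card K - card S)\<close>, and there are \<open>card K choose j\<close> subsets of size \<open>j\<close>.\<close>

lemma prob_card_bernoulli_marks:
  fixes B :: "'i \<Rightarrow> 'a \<Rightarrow> bool"
  assumes B: "indep_vars (\<lambda>_. count_space UNIV) B I"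
    and pB: "\<And>i. i \<in> I \<Longrightarrow> prob {\<omega> \<in> space M. B i \<omega>} = p"
    and K: "finite K" "K \<subseteq> I" and p: "0 \<le> p" "p \<le> 1"
  shows "prob {\<omega> \<in> space M. card {l\<in>K. B l \<omega>} \<in> A} = measure_pmf.prob (binomial_pmf (card K) p) A"
proof (rule prob_eq_prob_pmf)
  have rv[measurable]: "random_variable (count_space UNIV) (B i)" if "i \<in> I" for i
    using B that by (simp add: indep_vars_def2)
  have card_sum: "card {l\<in>K. B l \<omega>} = (\<Sum>l\<in>K. of_bool (B l \<omega>))" for \<omega>
    using K by (simp add: Int_def)
  show "random_variable (count_space UNIV) (\<lambda>\<omega>. card {l\<in>K. B l \<omega>})"
    unfolding card_sum
    by (intro measurable_sum_nat measurable_compose[OF rv]) (use K in auto)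
  fix j
  let ?E = "\<lambda>S. {\<omega> \<in> space M. {l\<in>K. B l \<omega>} = S}"
  have E: "?E S = (\<Inter>l\<in>K. B l -` {l \<in> S} \<inter> space M) \<inter> space M" if "S \<subseteq> K" for S
    using that by auto
  have ev: "?E S \<in> events" if "S \<subseteq> K" for S
  proof -
    have "?E S = {\<omega> \<in> space M. \<forall>l\<in>K. B l \<omega> = (l \<in> S)}" using that by auto
    also have "\<dots> \<in> events"
      by (rule sets.sets_Collect_finite_All[OF _ K(1)]) (use K in auto)
    finally show ?thesis .
  qed
  have prob_E: "prob (?E S) = p ^ card S * (1 - p) ^ (card K - card S)" if S: "S \<subseteq> K" for S
  proof (cases "K = {}")
    case True
    then have "S = {}" "?E S = space M" using S by auto
    then show ?thesis using True by (simp only: prob_space) simp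
  next
    case False
    have mark: "prob (B l -` {l \<in> S} \<inter> space M) = (if l \<in> S then p else 1 - p)" if "l \<in> K" for l
    proof -
      have l: "l \<in> I" using K that by auto
      then have [measurable]: "random_variable (count_space UNIV) (B l)" by (rule rv)
      have "prob {\<omega> \<in> space M. \<not> B l \<omega>} = 1 - p"
        using pB[OF l] prob_neg[of "B l"] l by simp
      moreover have "B l -` {True} \<inter> space M = {\<omega> \<in> space M. B l \<omega>}"
        "B l -` {False} \<inter> space M = {\<omega> \<in> space M. \<not> B l \<omega>}" by auto
      ultimately show ?thesis
        using pB[OF l] by (cases "l \<in> S") simp_all
    qed
    have "?E S = (\<Inter>l\<in>K. B l -` {l \<in> S} \<inter> space M)"
      using E[OF S] False by auto
    also have "prob \<dots> = (\<Prod>l\<in>K. prob (B l -` {l \<in> S} \<inter> space M))"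
      by (rule indep_varsD[OF B False]) (use K in auto)
    also have "\<dots> = (\<Prod>l\<in>K. if l \<in> S then p else 1 - p)"
      by (rule prod.cong) (use mark in auto)
    also have "\<dots> = p ^ card S * (1 - p) ^ card (K - S)"
      using K S by (simp add: prod.If_cases Int_absorb1 Diff_eq)
    finally show ?thesis
      using K S by (simp add: card_Diff_subset finite_subset)
  qed
  have "{\<omega> \<in> space M. card {l\<in>K. B l \<omega>} = j} = (\<Union>S\<in>{S. S \<subseteq> K \<and> card S = j}. ?E S)"
    by auto
  also have "prob \<dots> = (\<Sum>S | S \<subseteq> K \<and> card S = j. prob (?E S))"
    using K ev by (intro finite_measure_finite_Union) (auto simp: disjoint_family_on_def)
  also have "\<dots> = (\<Sum>S | S \<subseteq> K \<and> card S = j. p ^ j * (1 - p) ^ (card K - j))"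
    by (rule sum.cong) (auto simp: prob_E)
  also have "\<dots> = pmf (binomial_pmf (card K) p) j"
    using p K by (simp add: n_subsets)
  finally show "prob {\<omega> \<in> space M. card {l\<in>K. B l \<omega>} = j} = pmf (binomial_pmf (card K) p) j" .
qed

end

section \<open>Short increments of a process with stationary independent increments\<close>

lemma (in counting_process) increment_measurable:
  assumes "0 \<le> s" "0 \<le> t"
  shows "random_variable (count_space UNIV) (\<lambda>\<omega>. N t \<omega> - N s \<omega>)"
proof -
  note [measurable] = random_variable_process[OF assms(1)] random_variable_process[OF assms(2)]
  show ?thesis by measurable
qed

lemma (in counting_process) stationary_increments_prob:
  assumes "stationary_increments" and "0 \<le> t" "0 \<le> s"
  shows "prob {\<omega> \<in> space M. N (t + s) \<omega> - N t \<omega> \<in> A} = prob {\<omega> \<in> space M. N s \<omega> - N 0 \<omega> \<in> A}"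
proof -
  have "measure (distr M (count_space UNIV) (\<lambda>\<omega>. N (t + s) \<omega> - N t \<omega>)) A =
      measure (distr M (count_space UNIV) (\<lambda>\<omega>. N s \<omega> - N 0 \<omega>)) A"
    using assms by (simp add: stationary_increments_def)
  then show ?thesis
    using assms by (simp add: measure_distr increment_measurable vimage_def Int_def conj_commute)
qed

text \<open>The probability \<open>q s\<close> of no event in an interval of length \<open>s\<close> satisfies \<open>q (n * s) = q s ^ n\<close>.
  If \<open>q 1\<close> were \<open>0\<close>, then \<open>q (1 / n)\<close> would be \<open>0\<close> for every \<open>n\<close>, so almost surely each of \<open>n\<close>
  equal subintervals of \<open>[0, 1]\<close> would contain an event; then \<open>N 1\<close> would be at least \<open>n\<close> for every \<open>n\<close>. Hence
  \<open>q 1 > 0\<close>, and with about \<open>1 / s\<close> intervals of length \<open>s\<close> in \<open>[0, 1]\<close> the inequality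
  \<open>q 1 \<le> q s ^ n\<close> yields \<open>n * (1 - q s) \<le> - n * ln (q s) \<le> - ln (q 1)\<close>.\<close>

lemma (in counting_process) increment_nonzero_prob_linear:
  assumes st: "stationary_increments" and ind: "independent_increments"
  shows "\<exists>C. \<forall>s t. 0 < s \<longrightarrow> s \<le> 1 \<longrightarrow> 0 \<le> t \<longrightarrow>
           prob {\<omega> \<in> space M. N (t + s) \<omega> - N t \<omega> \<noteq> 0} \<le> C * s"
proof -
  define q where "q s = prob {\<omega> \<in> space M. N s \<omega> - N 0 \<omega> = 0}" for s
  have q_bounds: "0 \<le> q s" "q s \<le> 1" for s by (simp_all add: q_def)
  have rv[measurable]: "random_variable (count_space UNIV) (\<lambda>\<omega>. N t \<omega> - N s \<omega>)"
    if "0 \<le> s" "0 \<le> t" for s t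
    by (rule increment_measurable[OF that])
  have event: "{\<omega> \<in> space M. N t \<omega> - N s \<omega> \<in> A} \<in> events" if "0 \<le> s" "0 \<le> t" for s t A
    using measurable_sets[OF rv[OF that], of A] by (simp add: vimage_def Int_def conj_commute)
  have N_mono: "N s \<omega> \<le> N t \<omega>" if "0 \<le> s" "s \<le> t" "\<omega> \<in> space M" for s t \<omega>
    by (rule mono_onD[OF nondecreasing[OF that(3)]]) (use that in auto)
  have step: "prob {\<omega> \<in> space M. N (real (Suc i) * s) \<omega> - N (real i * s) \<omega> = 0} = q s"
    if "0 < s" for i s
    using stationary_increments_prob[OF st, of "real i * s" s "{0}"] that
    by (simp add: q_def algebra_simps)
  have q_power: "q (real n * s) = q s ^ n" if "0 < s" for n s
  proof (cases "n = 0")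
    case False
    have strict: "\<forall>i<n. real i * s < real (Suc i) * s" using that by simp
    let ?D = "\<lambda>i \<omega>. N (real (Suc i) * s) \<omega> - N (real i * s) \<omega>"
    have iv: "indep_vars (\<lambda>_. count_space UNIV) ?D {..<n}"
      using ind[unfolded independent_increments_def, rule_format, of "\<lambda>i. real i * s" n] strict by simp
    have "N (real n * s) \<omega> - N 0 \<omega> = 0 \<longleftrightarrow> (\<forall>i<n. ?D i \<omega> = 0)" if \<omega>: "\<omega> \<in> space M" for \<omega>
    proof
      assume zero: "N (real n * s) \<omega> - N 0 \<omega> = 0"
      show "\<forall>i<n. ?D i \<omega> = 0"
      proof (intro allI impI)
        fix i assume "i < n"
        then have "real (Suc i) * s \<le> real n * s"
          using \<open>0 < s\<close> by (intro mult_right_mono) auto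
        then have "N (real (Suc i) * s) \<omega> \<le> N (real n * s) \<omega>"
          using \<open>0 < s\<close> \<omega> by (intro N_mono) auto
        moreover have "N 0 \<omega> \<le> N (real i * s) \<omega>"
          using \<open>0 < s\<close> \<omega> by (intro N_mono) auto
        ultimately show "?D i \<omega> = 0" using zero by simp
      qed
    next
      assume zero: "\<forall>i<n. ?D i \<omega> = 0"
      have "N (real i * s) \<omega> \<le> N 0 \<omega>" if "i \<le> n" for i
        using that
      proof (induction i)
        case (Suc i)
        then have "?D i \<omega> = 0" using zero by simp
        then show ?case using Suc by simp
      qed simp
      then show "N (real n * s) \<omega> - N 0 \<omega> = 0" by simp
    qed
    then have "{\<omega> \<in> space M. N (real n * s) \<omega> - N 0 \<omega> = 0} = (\<Inter>i<n. ?D i -` {0} \<inter> space M)"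
      using False by auto
    then have "q (real n * s) = prob (\<Inter>i<n. ?D i -` {0} \<inter> space M)"
      by (simp only: q_def)
    also have "\<dots> = (\<Prod>i<n. prob (?D i -` {0} \<inter> space M))"
      by (rule indep_varsD[OF iv]) (use False in auto)
    also have "\<dots> = (\<Prod>i<n. q s)"
      using step[OF that] by (intro prod.cong) (simp_all add: vimage_def Int_def conj_commute)
    finally show ?thesis by simp
  qed (simp add: q_def prob_space)
  have "0 < q 1"
  proof (rule ccontr)
    assume "\<not> 0 < q 1"
    then have q1: "q 1 = 0" using q_bounds[of 1] by simp
    have null: "prob {\<omega> \<in> space M. N 1 \<omega> - N 0 \<omega> < n} = 0" for n
    proof (cases "n = 0")
      case False
      define s where "s = 1 / real n"
      have s: "0 < s" "real n * s = 1" using False by (simp_all add: s_def)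
      let ?D = "\<lambda>i \<omega>. N (real (Suc i) * s) \<omega> - N (real i * s) \<omega>"
      have "q s ^ n = 0" using q_power[OF s(1), of n] s(2) q1 by simp
      then have qs: "q s = 0" by simp
      have "{\<omega> \<in> space M. N 1 \<omega> - N 0 \<omega> < n} \<subseteq> (\<Union>i<n. {\<omega> \<in> space M. ?D i \<omega> = 0})"
      proof
        fix \<omega> assume \<omega>: "\<omega> \<in> {\<omega> \<in> space M. N 1 \<omega> - N 0 \<omega> < n}"
        show "\<omega> \<in> (\<Union>i<n. {\<omega> \<in> space M. ?D i \<omega> = 0})"
        proof (rule ccontr)
          assume none: "\<omega> \<notin> (\<Union>i<n. {\<omega> \<in> space M. ?D i \<omega> = 0})"
          have "N 0 \<omega> + i \<le> N (real i * s) \<omega>" if "i \<le> n" for i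
            using that
          proof (induction i)
            case (Suc i)
            then have "?D i \<omega> \<noteq> 0" using none \<omega> by auto
            then show ?case using Suc by simp
          qed simp
          from this[of n] show False using \<omega> s by auto
        qed
      qed
      then have "prob {\<omega> \<in> space M. N 1 \<omega> - N 0 \<omega> < n} \<le> prob (\<Union>i<n. {\<omega> \<in> space M. ?D i \<omega> = 0})"
        by (intro finite_measure_mono sets.finite_UN) (use event[of _ _ "{0}"] s in auto)
      also have "\<dots> \<le> (\<Sum>i<n. prob {\<omega> \<in> space M. ?D i \<omega> = 0})"
        by (intro finite_measure_subadditive_finite) (use event[of _ _ "{0}"] s in auto)
      also have "\<dots> = 0" by (simp only: step[OF s(1)] qs) simp
      finally show ?thesis by (simp add: measure_le_0_iff)
    qed simp
    have "(\<Union>n. {\<omega> \<in> space M. N 1 \<omega> - N 0 \<omega> < n}) = space M" by auto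
    moreover have "emeasure M (\<Union>n. {\<omega> \<in> space M. N 1 \<omega> - N 0 \<omega> < n}) = 0"
      by (rule emeasure_UN_eq_0)
         (use null event[of 0 1 "{..<_}"] in \<open>auto simp: emeasure_eq_measure\<close>)
    ultimately show False by (simp add: emeasure_space_1)
  qed
  show ?thesis
  proof (intro exI allI impI)
    fix s t :: real assume s: "0 < s" "s \<le> 1" and t: "0 \<le> t"
    \<comment> \<open>the number of whole intervals of length \<open>s\<close> in \<open>[0, 1]\<close>; they cover at least half of it\<close>
    define n where "n = nat \<lfloor>1 / s\<rfloor>"
    have n: "1 \<le> n" "real n * s \<le> 1" "1 \<le> 2 * (real n * s)"
    proof -
      have inv: "1 \<le> 1 / s" using s by simp
      then have floor_ge: "1 \<le> \<lfloor>1 / s\<rfloor>" by (simp only: one_le_floor)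
      then have n1: "1 \<le> n" unfolding n_def by linarith
      have real_n: "real n = of_int \<lfloor>1 / s\<rfloor>"
        unfolding n_def by (rule of_nat_nat) (use floor_ge in linarith)
      show "1 \<le> n" by (rule n1)
      have "real n \<le> 1 / s" unfolding real_n by (rule of_int_floor_le)
      then show "real n * s \<le> 1" using s by (simp add: field_simps)
      have "1 / s < real n + 1" unfolding real_n by (rule floor_correct[THEN conjunct2, simplified])
      also have "\<dots> \<le> 2 * real n" using n1 by simp
      finally show "1 \<le> 2 * (real n * s)" using s by (simp add: field_simps)
    qed
    have "q 1 \<le> q (real n * s)"
      unfolding q_def
    proof (rule finite_measure_mono)
      show "{\<omega> \<in> space M. N 1 \<omega> - N 0 \<omega> = 0} \<subseteq> {\<omega> \<in> space M. N (real n * s) \<omega> - N 0 \<omega> = 0}"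
        using N_mono[of "real n * s" 1] n s by fastforce
    qed (use event[of 0 "real n * s" "{0}"] s in simp)
    also have "\<dots> = q s ^ n" by (rule q_power[OF s(1)])
    finally have q1n: "q 1 \<le> q s ^ n" .
    have qs: "0 < q s"
      using q1n \<open>0 < q 1\<close> n q_bounds[of s] by (cases "q s = 0") (auto simp: zero_power)
    have "ln (q 1) \<le> real n * ln (q s)"
      using q1n \<open>0 < q 1\<close> qs by (subst ln_realpow[symmetric]) auto
    also have "\<dots> \<le> real n * (q s - 1)"
      using ln_le_minus_one[OF qs] by (intro mult_left_mono) auto
    finally have "real n * (1 - q s) \<le> - ln (q 1)" by (simp add: algebra_simps)
    then have "2 * s * (real n * (1 - q s)) \<le> 2 * s * - ln (q 1)"
      using s by (intro mult_left_mono) auto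
    moreover have "1 * (1 - q s) \<le> 2 * (real n * s) * (1 - q s)"
      using n q_bounds[of s] by (intro mult_right_mono) auto
    moreover have "prob {\<omega> \<in> space M. N (t + s) \<omega> - N t \<omega> \<noteq> 0} = 1 - q s"
    proof -
      have "prob {\<omega> \<in> space M. N (t + s) \<omega> - N t \<omega> = 0} = q s"
        using stationary_increments_prob[OF st t, of s "{0}"] s by (simp add: q_def)
      then show ?thesis
        using prob_neg[of "\<lambda>\<omega>. N (t + s) \<omega> - N t \<omega> = 0"] event[of t "t + s" "{0}"] s t by simp
    qed
    ultimately show "prob {\<omega> \<in> space M. N (t + s) \<omega> - N t \<omega> \<noteq> 0} \<le> (- 2 * ln (q 1)) * s"
      by (simp add: algebra_simps)
  qed
qed

section \<open>Increments of the thinned process\<close>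

lemma card_marked_difference:
  fixes m n :: nat
  assumes "m \<le> n"
  shows "card {i. i < n \<and> P i} - card {i. i < m \<and> P i} = card {i\<in>{m..<n}. P i}"
proof -
  have "{i\<in>{m..<n}. P i} = {i. i < n \<and> P i} - {i. i < m \<and> P i}" by auto
  then show ?thesis
    using assms by (simp add: card_Diff_subset Collect_mono)
qed

text \<open>
  A decomposition with its marks \<open>B\<close> made explicit. Only the counting process structure of \<open>N\<close> is
  assumed, because the formula for the joint law of the increments of \<open>N1\<close> holds for every such \<open>N\<close>.
\<close>

locale marked_counting_process = counting_process M N
  for M :: "'a measure" and N :: "real \<Rightarrow> 'a \<Rightarrow> nat" +
  fixes p :: real and B :: "nat \<Rightarrow> 'a \<Rightarrow> bool" and N1 :: "real \<Rightarrow> 'a \<Rightarrow> nat"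
  assumes marks_indep: "indep_vars (\<lambda>_. count_space UNIV) B UNIV"
    and mark_prob: "\<And>i. prob {\<omega> \<in> space M. B i \<omega>} = p"
    and process_marks_indep: "indep_set
          (sets (vimage_algebra (space M) (\<lambda>\<omega>. \<lambda>t\<in>{0..}. N t \<omega>)
                   (\<Pi>\<^sub>M t\<in>{0::real..}. count_space (UNIV :: nat set))))
          (sets (vimage_algebra (space M) (\<lambda>\<omega> i. B i \<omega>)
                   (\<Pi>\<^sub>M i\<in>UNIV. count_space (UNIV :: bool set))))"
    and N1_eq: "\<And>t \<omega>. 0 \<le> t \<Longrightarrow> \<omega> \<in> space M \<Longrightarrow> N1 t \<omega> = card {i. i < N t \<omega> \<and> B i \<omega>}"
begin

lemma p_bounds: "0 \<le> p" "p \<le> 1"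
  using mark_prob[of 0] by (metis measure_nonneg) (metis mark_prob prob_le_1)

lemma mark_measurable [measurable]: "random_variable (count_space UNIV) (B i)"
  using marks_indep by (simp add: indep_vars_def2)

lemma N1_measurable:
  assumes "0 \<le> t"
  shows "random_variable (count_space UNIV) (N1 t)"
proof -
  note [measurable] = random_variable_process[OF assms]
  have "(\<lambda>\<omega>. card {i. i < n \<and> B i \<omega>}) = (\<lambda>\<omega>. \<Sum>i<n. of_bool (B i \<omega>))" for n
    by (auto simp: Int_def conj_commute intro!: arg_cong[where f = card])
  then have "(\<lambda>\<omega>. card {i. i < n \<and> B i \<omega>}) \<in> measurable M (count_space UNIV)" for n
    by (simp only:) measurable
  then have "(\<lambda>\<omega>. card {i. i < N t \<omega> \<and> B i \<omega>}) \<in> measurable M (count_space UNIV)"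
    by (rule measurable_compose_countable) measurable
  then show ?thesis
    by (subst measurable_cong[OF N1_eq[OF assms]])
qed

lemma N1_counting: "counting_process M N1"
proof unfold_locales
  show "random_variable (count_space UNIV) (N1 t)" if "0 \<le> t" for t
    by (rule N1_measurable[OF that])
  show "mono_on {0..} (\<lambda>t. N1 t \<omega>)" if "\<omega> \<in> space M" for \<omega>
  proof (rule mono_onI)
    fix s t :: real assume st: "s \<in> {0..}" "t \<in> {0..}" "s \<le> t"
    then have "N s \<omega> \<le> N t \<omega>" by (rule mono_onD[OF nondecreasing[OF that]])
    then show "N1 s \<omega> \<le> N1 t \<omega>"
      using st that by (auto simp: N1_eq intro!: card_mono)
  qed
qed

text \<open>Disjoint blocks of indices carry independent marks, so the numbers of marks in them are
  independent binomial variables.\<close>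

lemma prob_blocks:
  fixes m :: "nat \<Rightarrow> nat" and A :: "nat \<Rightarrow> nat set"
  assumes m: "\<And>i. i < n \<Longrightarrow> m i \<le> m (Suc i)"
  shows "prob {\<omega> \<in> space M. \<forall>i<n. card {l\<in>{m i..<m (Suc i)}. B l \<omega>} \<in> A i} =
           (\<Prod>i<n. measure_pmf.prob (binomial_pmf (m (Suc i) - m i) p) (A i))"
proof (cases "n = 0")
  case True
  then show ?thesis by (simp add: prob_space)
next
  case False
  let ?K = "\<lambda>i. {m i..<m (Suc i)}"
  have mono: "m i \<le> m j" if "i \<le> j" "j \<le> n" for i j
    using that
  proof (induction j rule: dec_induct)
    case (step k)
    then show ?case using m[of k] by simp
  qed simp
  have disj: "disjoint_family_on ?K {..<n}"
    unfolding disjoint_family_on_def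
  proof (intro ballI impI)
    fix i j assume "i \<in> {..<n}" "j \<in> {..<n}" "i \<noteq> j"
    then consider "m (Suc i) \<le> m j" | "m (Suc j) \<le> m i"
      using mono[of "Suc i" j] mono[of "Suc j" i] by (auto simp: neq_iff)
    then show "?K i \<inter> ?K j = {}" by cases auto
  qed
  have "indep_vars (\<lambda>i. PiM (?K i) (\<lambda>_. count_space UNIV))
          (\<lambda>i \<omega>. restrict (\<lambda>l. B l \<omega>) (?K i)) {..<n}"
    by (rule indep_vars_restrict[OF marks_indep _ disj]) auto
  then have "indep_vars (\<lambda>_. count_space UNIV)
          (\<lambda>i \<omega>. (\<Sum>l\<in>?K i. of_bool (restrict (\<lambda>l. B l \<omega>) (?K i) l) :: nat)) {..<n}"
    by (rule indep_vars_compose2[where Y = "\<lambda>i g. \<Sum>l\<in>?K i. of_bool (g l)"]) measurable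
  moreover have "(\<Sum>l\<in>?K i. of_bool (restrict (\<lambda>l. B l \<omega>) (?K i) l) :: nat) =
      card {l\<in>?K i. B l \<omega>}" for i \<omega>
    by (simp add: Int_def)
  ultimately have ind: "indep_vars (\<lambda>_. count_space UNIV) (\<lambda>i \<omega>. card {l\<in>?K i. B l \<omega>}) {..<n}"
    by (simp only:)
  have "{\<omega> \<in> space M. \<forall>i<n. card {l\<in>?K i. B l \<omega>} \<in> A i} =
      (\<Inter>i<n. (\<lambda>\<omega>. card {l\<in>?K i. B l \<omega>}) -` A i \<inter> space M)"
    using False by auto
  also have "prob \<dots> = (\<Prod>i<n. prob ((\<lambda>\<omega>. card {l\<in>?K i. B l \<omega>}) -` A i \<inter> space M))"
    by (rule indep_varsD[OF ind]) (use False in auto)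
  also have "\<dots> = (\<Prod>i<n. measure_pmf.prob (binomial_pmf (m (Suc i) - m i) p) (A i))"
  proof (rule prod.cong)
    fix i
    show "prob ((\<lambda>\<omega>. card {l\<in>?K i. B l \<omega>}) -` A i \<inter> space M) =
        measure_pmf.prob (binomial_pmf (m (Suc i) - m i) p) (A i)"
      using prob_card_bernoulli_marks[OF marks_indep mark_prob _ _ p_bounds, of "?K i" "A i"]
      by (simp add: vimage_def Int_def conj_commute)
  qed simp
  finally show ?thesis .
qed

text \<open>The central formula. The vector of values \<open>N (\<tau> 0), \<dots>, N (\<tau> n)\<close> is encoded as a list, so that
  it takes values in a countable type, and is mixed over; for each fixed vector the increments of
  \<open>N1\<close> are the mark counts of consecutive blocks. General sets \<open>A i\<close>, rather than single values,
  let independence of the increments be read off directly.\<close>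

lemma prob_thinned_increments:
  fixes \<tau> :: "nat \<Rightarrow> real" and A :: "nat \<Rightarrow> nat set"
  assumes "0 \<le> \<tau> 0" and "\<And>i. i < n \<Longrightarrow> \<tau> i \<le> \<tau> (Suc i)"
  shows "prob {\<omega> \<in> space M. \<forall>i<n. N1 (\<tau> (Suc i)) \<omega> - N1 (\<tau> i) \<omega> \<in> A i} =
           expectation (\<lambda>\<omega>. \<Prod>i<n.
             measure_pmf.prob (binomial_pmf (N (\<tau> (Suc i)) \<omega> - N (\<tau> i) \<omega>) p) (A i))"
proof -
  have \<tau>_nonneg: "0 \<le> \<tau> i" if "i \<le> n" for i
    using that
  proof (induction i)
    case (Suc i)
    then show ?case using assms(2)[of i] by simp
  qed (use assms in simp)
  have N_mono: "N (\<tau> i) \<omega> \<le> N (\<tau> (Suc i)) \<omega>" if "i < n" "\<omega> \<in> space M" for i \<omega>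
    by (rule mono_onD[OF nondecreasing[OF that(2)]])
       (use that \<tau>_nonneg[of i] \<tau>_nonneg[of "Suc i"] assms(2)[of i] in auto)
  define X where "X \<omega> = map (\<lambda>i. N (\<tau> i) \<omega>) [0..<Suc n]" for \<omega>
  \<comment> \<open>only \<open>Q (X \<omega>)\<close> matters, whose list of block boundaries is nondecreasing\<close>
  define Q where "Q m = {\<omega> \<in> space M. \<forall>i<n. card {l\<in>{m ! i..<m ! Suc i}. B l \<omega>} \<in> A i}"
    for m :: "nat list"
  have X_nth: "X \<omega> ! i = N (\<tau> i) \<omega>" if "i \<le> n" for i \<omega>
    using that by (simp add: X_def del: upt_Suc)
  have N1_diff: "N1 (\<tau> (Suc i)) \<omega> - N1 (\<tau> i) \<omega> = card {l\<in>{X \<omega> ! i..<X \<omega> ! Suc i}. B l \<omega>}"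
    if "i < n" "\<omega> \<in> space M" for i \<omega>
    using that \<tau>_nonneg[of i] \<tau>_nonneg[of "Suc i"] N_mono[OF that]
    by (simp add: N1_eq X_nth card_marked_difference)
  let ?PN = "\<Pi>\<^sub>M t\<in>{0::real..}. count_space (UNIV :: nat set)"
  let ?PB = "\<Pi>\<^sub>M i\<in>(UNIV :: nat set). count_space (UNIV :: bool set)"
  have X_event: "{\<omega> \<in> space M. X \<omega> = x} \<in>
      sets (vimage_algebra (space M) (\<lambda>\<omega>. \<lambda>t\<in>{0..}. N t \<omega>) ?PN)" for x
  proof (cases "length x = Suc n")
    case True
    have [measurable]: "(\<lambda>f. f (\<tau> i)) \<in> measurable ?PN (count_space UNIV)" if "i \<le> n" for i
      by (rule measurable_component_singleton) (use \<tau>_nonneg that in auto)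
    have "{f \<in> space ?PN. \<forall>i\<in>{..n}. f (\<tau> i) = x ! i} \<in> sets ?PN"
      by (rule sets.sets_Collect_finite_All) auto
    moreover have "{\<omega> \<in> space M. X \<omega> = x} =
        (\<lambda>\<omega>. \<lambda>t\<in>{0..}. N t \<omega>) -` {f \<in> space ?PN. \<forall>i\<in>{..n}. f (\<tau> i) = x ! i} \<inter> space M"
      using True \<tau>_nonneg
      by (auto simp: space_PiM X_def list_eq_iff_nth_eq less_Suc_eq_le simp del: upt_Suc)
    ultimately show ?thesis by (simp only: in_vimage_algebra)
  next
    case False
    then have "{\<omega> \<in> space M. X \<omega> = x} = {}" by (auto simp: X_def)
    then show ?thesis by (simp only: sets.empty_sets)
  qed
  have Q_event: "Q m \<in> sets (vimage_algebra (space M) (\<lambda>\<omega> i. B i \<omega>) ?PB)" for m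
  proof -
    let ?c = "\<lambda>i f. card {l\<in>{m ! i..<m ! Suc i}. f l}"
    have "?c i = (\<lambda>f. \<Sum>l\<in>{m ! i..<m ! Suc i}. of_bool (f l))" for i
      by (auto simp: Int_def)
    then have [measurable]: "?c i \<in> measurable ?PB (count_space UNIV)" for i
      by (simp only:) measurable
    have "{f \<in> space ?PB. \<forall>i\<in>{..<n}. ?c i f \<in> A i} \<in> sets ?PB"
      by (rule sets.sets_Collect_finite_All) auto
    moreover have "Q m = (\<lambda>\<omega> i. B i \<omega>) -` {f \<in> space ?PB. \<forall>i\<in>{..<n}. ?c i f \<in> A i} \<inter> space M"
      by (auto simp: Q_def space_PiM)
    ultimately show ?thesis by (simp only: in_vimage_algebra)
  qed
  have "{\<omega> \<in> space M. \<forall>i<n. N1 (\<tau> (Suc i)) \<omega> - N1 (\<tau> i) \<omega> \<in> A i} =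
      {\<omega> \<in> space M. \<omega> \<in> Q (X \<omega>)}"
    using N1_diff by (auto simp: Q_def)
  also have "prob \<dots> = expectation (\<lambda>\<omega>. prob (Q (X \<omega>)))"
    by (rule prob_mixture[OF process_marks_indep X_event Q_event])
  also have "\<dots> = expectation (\<lambda>\<omega>. \<Prod>i<n.
      measure_pmf.prob (binomial_pmf (N (\<tau> (Suc i)) \<omega> - N (\<tau> i) \<omega>) p) (A i))"
  proof (rule Bochner_Integration.integral_cong)
    fix \<omega> assume \<omega>: "\<omega> \<in> space M"
    have "prob (Q (X \<omega>)) =
        (\<Prod>i<n. measure_pmf.prob (binomial_pmf (X \<omega> ! Suc i - X \<omega> ! i) p) (A i))"
      unfolding Q_def by (rule prob_blocks) (use N_mono \<omega> X_nth in auto)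
    also have "\<dots> = (\<Prod>i<n.
        measure_pmf.prob (binomial_pmf (N (\<tau> (Suc i)) \<omega> - N (\<tau> i) \<omega>) p) (A i))"
      by (rule prod.cong) (auto simp: X_nth)
    finally show "prob (Q (X \<omega>)) = \<dots>" .
  qed simp
  finally show ?thesis .
qed

lemma prob_thinned_increment:
  assumes "0 \<le> s" "s \<le> t"
  shows "prob {\<omega> \<in> space M. N1 t \<omega> - N1 s \<omega> \<in> A} =
           expectation (\<lambda>\<omega>. measure_pmf.prob (binomial_pmf (N t \<omega> - N s \<omega>) p) A)"
  using prob_thinned_increments[of "\<lambda>i. if i = 0 then s else t" 1 "\<lambda>_. A"] assms
  by simp

lemma N1_increment_measurable:
  assumes "0 \<le> s" "0 \<le> t"
  shows "random_variable (count_space UNIV) (\<lambda>\<omega>. N1 t \<omega> - N1 s \<omega>)"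
  by (rule counting_process.increment_measurable[OF N1_counting assms])

text \<open>By the formula for one increment, its law is a function of the law of the increment of \<open>N\<close> over
  the same interval.\<close>

lemma thinned_stationary:
  assumes "stationary_increments"
  shows "counting_process.stationary_increments M N1"
  unfolding counting_process.stationary_increments_def[OF N1_counting]
proof (intro allI impI)
  fix t s :: real assume ts: "0 \<le> t" "0 \<le> s"
  show "distr M (count_space UNIV) (\<lambda>\<omega>. N1 (t + s) \<omega> - N1 t \<omega>) =
        distr M (count_space UNIV) (\<lambda>\<omega>. N1 s \<omega> - N1 0 \<omega>)"
  proof (rule measure_eqI)
    fix A :: "nat set"
    let ?g = "\<lambda>k. measure_pmf.prob (binomial_pmf k p) A"
    have em: "emeasure (distr M (count_space UNIV) (\<lambda>\<omega>. N1 b \<omega> - N1 a \<omega>)) A =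
        ennreal (\<integral>k. ?g k \<partial>distr M (count_space UNIV) (\<lambda>\<omega>. N b \<omega> - N a \<omega>))"
      if "0 \<le> a" "a \<le> b" for a b
    proof -
      have "emeasure (distr M (count_space UNIV) (\<lambda>\<omega>. N1 b \<omega> - N1 a \<omega>)) A =
          ennreal (prob {\<omega> \<in> space M. N1 b \<omega> - N1 a \<omega> \<in> A})"
        using that by (simp add: emeasure_distr increment_measurable N1_increment_measurable
            emeasure_eq_measure vimage_def Int_def conj_commute)
      then show ?thesis
        using that by (simp add: prob_thinned_increment integral_distr increment_measurable N1_increment_measurable)
    qed
    have "distr M (count_space UNIV) (\<lambda>\<omega>. N (t + s) \<omega> - N t \<omega>) =
        distr M (count_space UNIV) (\<lambda>\<omega>. N s \<omega> - N 0 \<omega>)"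
      using assms ts by (simp add: stationary_increments_def)
    then show "emeasure (distr M (count_space UNIV) (\<lambda>\<omega>. N1 (t + s) \<omega> - N1 t \<omega>)) A =
        emeasure (distr M (count_space UNIV) (\<lambda>\<omega>. N1 s \<omega> - N1 0 \<omega>)) A"
      using ts by (simp add: em)
  qed simp
qed

text \<open>The central formula turns the joint probability into the expectation of a product of functions of
  the independent increments of \<open>N\<close>; it factorises, and each factor is again given by the formula.\<close>

lemma thinned_independent:
  assumes "independent_increments"
  shows "counting_process.independent_increments M N1"
  unfolding counting_process.independent_increments_def[OF N1_counting]
proof (intro allI impI)
  fix n :: nat and \<tau> :: "nat \<Rightarrow> real"
  assume \<tau>0: "0 \<le> \<tau> 0" and \<tau>: "\<forall>i<n. \<tau> i < \<tau> (Suc i)"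
  let ?D = "\<lambda>i \<omega>. N (\<tau> (Suc i)) \<omega> - N (\<tau> i) \<omega>"
  let ?D1 = "\<lambda>i \<omega>. N1 (\<tau> (Suc i)) \<omega> - N1 (\<tau> i) \<omega>"
  have \<tau>_nonneg: "0 \<le> \<tau> i" if "i \<le> n" for i
    using that
  proof (induction i)
    case (Suc i)
    then show ?case using \<tau> by (metis Suc_le_lessD less_imp_le order.trans)
  qed (use \<tau>0 in simp)
  have ind: "indep_vars (\<lambda>_. count_space UNIV) ?D {..<n}"
    using assms \<tau>0 \<tau> by (auto simp: independent_increments_def)
  show "indep_vars (\<lambda>_. count_space UNIV) ?D1 {..<n}"
  proof (cases "n = 0")
    case True
    then show ?thesis by (simp add: indep_vars_def indep_sets_def)
  next
    case False
    have "prob (\<Inter>i<n. ?D1 i -` A i \<inter> space M) = (\<Prod>i<n. prob (?D1 i -` A i \<inter> space M))" for A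
    proof -
      let ?g = "\<lambda>i k. measure_pmf.prob (binomial_pmf k p) (A i)"
      have ind_g: "indep_vars (\<lambda>_. borel) (\<lambda>i \<omega>. ?g i (?D i \<omega>)) {..<n}"
        by (rule indep_vars_compose2[OF ind]) simp
      have "(\<Inter>i<n. ?D1 i -` A i \<inter> space M) = {\<omega> \<in> space M. \<forall>i<n. ?D1 i \<omega> \<in> A i}"
        using False by auto
      then have "prob (\<Inter>i<n. ?D1 i -` A i \<inter> space M) = expectation (\<lambda>\<omega>. \<Prod>i<n. ?g i (?D i \<omega>))"
        using \<tau>0 \<tau> by (simp add: prob_thinned_increments less_imp_le)
      also have "\<dots> = (\<Prod>i<n. expectation (\<lambda>\<omega>. ?g i (?D i \<omega>)))"
      proof (rule indep_vars_lebesgue_integral[OF _ ind_g])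
        fix i assume "i \<in> {..<n}"
        then have "random_variable borel (\<lambda>\<omega>. ?g i (?D i \<omega>))"
          using ind_g by (simp add: indep_vars_def2)
        then show "integrable M (\<lambda>\<omega>. ?g i (?D i \<omega>))"
          by (intro integrable_const_bound[where B = 1]) auto
      qed simp
      also have "\<dots> = (\<Prod>i<n. prob (?D1 i -` A i \<inter> space M))"
      proof (rule prod.cong)
        fix i assume "i \<in> {..<n}"
        then show "expectation (\<lambda>\<omega>. ?g i (?D i \<omega>)) = prob (?D1 i -` A i \<inter> space M)"
          using \<tau> \<tau>_nonneg[of i] prob_thinned_increment[of "\<tau> i" "\<tau> (Suc i)" "A i"]
          by (simp add: vimage_def Int_def conj_commute less_imp_le)
      qed simp
      finally show ?thesis .
    qed
    then show ?thesis
      using False \<tau>_nonneg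
      by (subst indep_vars_finite[where E = "\<lambda>_. UNIV"])
         (auto simp: Int_stable_def increment_measurable N1_increment_measurable intro!: sigma_sets.Basic)
  qed
qed

text \<open>The remainders \<open>f s k\<close> after division by \<open>s\<close> are summed against the weights \<open>w k\<close>. The term
  \<open>k = 0\<close> is set to \<open>0\<close>: there \<open>P s 0\<close> tends to \<open>1\<close> and its quotient by \<open>s\<close> is unbounded, but its
  weight vanishes because \<open>j \<ge> 1\<close>.\<close>

lemma thinned_increment_prob:
  assumes st: "stationary_increments" and ind: "independent_increments"
    and p: "0 < p" "p < 1" and \<theta>: "0 < \<theta>" and \<alpha>: "0 < \<alpha>" and t: "0 \<le> t" and j: "1 \<le> j"
    and rate: "\<And>k. 1 \<le> k \<Longrightarrow>
      (\<lambda>s. prob {\<omega> \<in> space M. N (t + s) \<omega> - N t \<omega> = k} - \<alpha> * s * \<theta> ^ k / fact k)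
        \<in> o[at_right 0](\<lambda>s. s)"
  shows "(\<lambda>s. prob {\<omega> \<in> space M. N1 (t + s) \<omega> - N1 t \<omega> = j}
              - \<alpha> * exp ((1 - p) * \<theta>) * s * (p * \<theta>) ^ j / fact j) \<in> o[at_right 0](\<lambda>s. s)"
proof -
  define P where "P s k = prob {\<omega> \<in> space M. N (t + s) \<omega> - N t \<omega> = k}" for s k
  define w where "w k = pmf (binomial_pmf k p) j" for k
  define \<pi> where "\<pi> k = \<alpha> * \<theta> ^ k / fact k" for k :: nat
  define f where "f s k = (if k = 0 then 0 else P s k / s - \<pi> k)" for s k
  obtain C where C: "\<And>s. 0 < s \<Longrightarrow> s \<le> 1 \<Longrightarrow>
      prob {\<omega> \<in> space M. N (t + s) \<omega> - N t \<omega> \<noteq> 0} \<le> C * s"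
    using increment_nonzero_prob_linear[OF st ind] t by metis
  have w0: "w 0 = 0" using j p by (simp add: w_def)
  have near0: "\<forall>\<^sub>F s in at_right 0. 0 < s \<and> s \<le> (1::real)"
    by (auto simp: eventually_at_right_field intro!: exI[of _ 1])
  have \<pi>_sums: "\<pi> sums (\<alpha> * exp \<theta>)"
    using sums_mult[OF exp_converges[of \<theta>], of \<alpha>] by (simp add: \<pi>_def[abs_def] field_simps)
  have rv: "random_variable (count_space UNIV) (\<lambda>\<omega>. N (t + s) \<omega> - N t \<omega>)" if "0 < s" for s
    using t that by (intro increment_measurable) auto
  have P_sums: "P s sums 1" if "0 < s" for s
    using expectation_discrete_sums[OF rv[OF that], of "\<lambda>_. 1"] by (simp add: P_def[abs_def] prob_space)
  have \<pi>_nonneg: "0 \<le> \<pi> k" for k using \<alpha> \<theta> by (simp add: \<pi>_def)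
  have P_nonneg: "0 \<le> P s k" for s k by (simp add: P_def)
  have "((\<lambda>s. \<Sum>k. w k * f s k) \<longlongrightarrow> 0) (at_right 0)"
  proof (rule tendsto_suminf_vanishing_weights)
    show "w \<longlonglongrightarrow> 0"
      unfolding w_def[abs_def] by (rule binomial_weight_tendsto_0[OF p j])
    show "\<forall>\<^sub>F s in at_right 0. summable (\<lambda>k. \<bar>f s k\<bar>) \<and> (\<Sum>k. \<bar>f s k\<bar>) \<le> C + \<alpha> * exp \<theta>"
      using near0
    proof eventually_elim
      case (elim s)
      \<comment> \<open>the mass off \<open>0\<close> is the probability of a nonzero increment, which is linear in \<open>s\<close>\<close>
      have "(\<lambda>k. P s (Suc k)) sums (1 - P s 0)"
        using P_sums[of s] elim by (simp add: sums_Suc_iff)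
      then have "(\<lambda>k. if k = 0 then 0 else P s k) sums (1 - P s 0)"
        by (subst sums_Suc_iff[symmetric, where f = "\<lambda>k. if k = 0 then 0 else P s k", simplified])
      then have maj: "(\<lambda>k. (if k = 0 then 0 else P s k) / s + \<pi> k) sums ((1 - P s 0) / s + \<alpha> * exp \<theta>)"
        by (intro sums_add sums_divide \<pi>_sums)
      have bound: "\<bar>f s k\<bar> \<le> (if k = 0 then 0 else P s k) / s + \<pi> k" for k
        using elim \<pi>_nonneg[of k] P_nonneg[of s k] by (auto simp: f_def abs_le_iff)
      have summ: "summable (\<lambda>k. \<bar>f s k\<bar>)"
        by (rule summable_comparison_test'[OF sums_summable[OF maj], of 0]) (use bound in auto)
      have "(\<Sum>k. \<bar>f s k\<bar>) \<le> (1 - P s 0) / s + \<alpha> * exp \<theta>"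
        using suminf_le[OF bound summ sums_summable[OF maj]] sums_unique[OF maj] by simp
      also have "1 - P s 0 = prob {\<omega> \<in> space M. N (t + s) \<omega> - N t \<omega> \<noteq> 0}"
      proof -
        have [measurable]: "random_variable (count_space UNIV) (\<lambda>\<omega>. N (t + s) \<omega> - N t \<omega>)"
          using rv elim by blast
        have "{\<omega> \<in> space M. N (t + s) \<omega> - N t \<omega> = 0} \<in> events" by measurable
        then show ?thesis unfolding P_def by (rule prob_neg[symmetric])
      qed
      also have "\<dots> / s \<le> C"
        using C[of s] elim by (simp add: divide_le_eq)
      finally show ?case using summ by simp
    qed
    show "((\<lambda>s. f s k) \<longlongrightarrow> 0) (at_right 0)" for k
    proof (cases "k = 0")
      case False
      have "((\<lambda>s. (P s k - \<alpha> * s * \<theta> ^ k / fact k) / s) \<longlongrightarrow> 0) (at_right 0)"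
        using rate[of k] False by (intro smalloD_tendsto) (simp add: P_def)
      then show ?thesis
      proof (rule Lim_transform_eventually)
        show "\<forall>\<^sub>F s in at_right 0. (P s k - \<alpha> * s * \<theta> ^ k / fact k) / s = f s k"
          using near0 by eventually_elim (use False in \<open>simp add: f_def \<pi>_def field_simps\<close>)
      qed
    qed (simp add: f_def)
  qed
  moreover have "\<forall>\<^sub>F s in at_right 0. (\<Sum>k. w k * f s k) =
      (prob {\<omega> \<in> space M. N1 (t + s) \<omega> - N1 t \<omega> = j}
        - \<alpha> * exp ((1 - p) * \<theta>) * s * (p * \<theta>) ^ j / fact j) / s"
    using near0
  proof eventually_elim
    case (elim s)
    have "(\<lambda>k. w k * P s k) sums prob {\<omega> \<in> space M. N1 (t + s) \<omega> - N1 t \<omega> = j}"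
      using expectation_discrete_sums[of "\<lambda>\<omega>. N (t + s) \<omega> - N t \<omega>" w]
        prob_thinned_increment[of t "t + s" "{j}"] t elim rv[of s]
      by (simp add: w_def[abs_def] P_def pmf_le_1 measure_pmf_single)
    moreover have "(\<lambda>k. \<alpha> * (w k * (\<theta> ^ k / fact k))) sums
        (\<alpha> * (exp ((1 - p) * \<theta>) * (p * \<theta>) ^ j / fact j))"
      unfolding w_def by (intro sums_mult binomial_thinning_of_exponential_weights) (use p in auto)
    ultimately have "(\<lambda>k. w k * P s k / s - \<alpha> * (w k * (\<theta> ^ k / fact k))) sums
        (prob {\<omega> \<in> space M. N1 (t + s) \<omega> - N1 t \<omega> = j} / s -
          \<alpha> * (exp ((1 - p) * \<theta>) * (p * \<theta>) ^ j / fact j))"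
      by (intro sums_diff sums_divide)
    moreover have "w k * P s k / s - \<alpha> * (w k * (\<theta> ^ k / fact k)) = w k * f s k" for k
      using w0 by (cases "k = 0") (simp_all add: f_def \<pi>_def algebra_simps)
    ultimately have "(\<lambda>k. w k * f s k) sums
        (prob {\<omega> \<in> space M. N1 (t + s) \<omega> - N1 t \<omega> = j} / s -
          \<alpha> * (exp ((1 - p) * \<theta>) * (p * \<theta>) ^ j / fact j))"
      by simp
    then show ?case
      using elim by (simp add: sums_iff diff_divide_distrib)
  qed
  ultimately have "((\<lambda>s. (prob {\<omega> \<in> space M. N1 (t + s) \<omega> - N1 t \<omega> = j}
      - \<alpha> * exp ((1 - p) * \<theta>) * s * (p * \<theta>) ^ j / fact j) / s) \<longlongrightarrow> 0) (at_right 0)"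
    by (rule Lim_transform_eventually)
  then show ?thesis
    by (rule smalloI_tendsto) (use near0 in \<open>auto elim: eventually_mono\<close>)
qed

end

section \<open>Thinning of a Bell-Touchard process\<close>

theorem corollary3p2p1:
  fixes M :: "'a measure" and N N1 :: "real \<Rightarrow> 'a \<Rightarrow> nat" and \<alpha> \<theta> p :: real
  assumes "0 < \<alpha>" and "0 < \<theta>" and "0 < p" and "p < 1"
    and "bell_touchard_process M N \<alpha> \<theta>"
    and "prob_space.decomposition M N p N1"
  shows "bell_touchard_process M N1 (\<alpha> * exp ((1 - p) * \<theta>)) (p * \<theta>)"
proof -
  interpret N: bell_touchard_process M N \<alpha> \<theta> by (rule assms)
  obtain B :: "nat \<Rightarrow> 'a \<Rightarrow> bool" where "marked_counting_process M N p B N1"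
    using assms(6) N.counting_process_axioms
    unfolding N.decomposition_def marked_counting_process_def marked_counting_process_axioms_def
    by blast
  then interpret marked_counting_process M N p B N1 .
  interpret N1: counting_process M N1 by (rule N1_counting)
  show ?thesis
  proof unfold_locales
    show "0 < \<alpha> * exp ((1 - p) * \<theta>)" "0 < p * \<theta>"
      using assms by simp_all
    show "N1 0 \<omega> = 0" if "\<omega> \<in> space M" for \<omega>
      using that by (simp add: N1_eq N.starts_at_zero)
    show "N1.stationary_increments"
      by (rule thinned_stationary[OF N.stationary])
    show "N1.independent_increments"
      by (rule thinned_independent[OF N.independent])
    show "(\<lambda>s. N.prob {\<omega> \<in> space M. N1 (t + s) \<omega> - N1 t \<omega> = k}
            - \<alpha> * exp ((1 - p) * \<theta>) * s * (p * \<theta>) ^ k / fact k) \<in> o[at_right 0](\<lambda>s. s)"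
      if "1 \<le> k" "0 < t" for k :: nat and t :: real
      by (rule thinned_increment_prob[OF N.stationary N.independent])
         (use assms that N.increment_prob in auto)
  qed
qed

end
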